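(* Let $n\ge 4$ be even. If $G$ is a simple graph with $n$ vertices and $m$ edges that has a maximal edge coloring, then $m \ge \frac{1}{4}n^2$. Equivalently, every $m \in MEC(n)$ satisfies $m\ge \frac14 n^2$.
   Context: All graphs are finite and simple. The chromatic index of the complete graph is $\chi'(K_n)=n-1$ for even $n$ and $\chi'(K_n)=n$ for odd $n$. A graph $G$ of order $n$ has a maximal edge coloring if there is a proper edge coloring of $G$ using a palette of $\chi'(K_n)$ colors such that adding to $G$ any edge not already in $G$, in any color of the palette, makes the coloring improper (i.e., for every non-adjacent pair of distinct vertices $u,v$ and every color $c$ of the palette, $c$ already appears on an edge incident to $u$ or to $v$). $MEC(n)$ is the set of all nonnegative integers $m$ such that there exists a graph with $n$ vertices and $m$ edges having a maximal edge coloring. *)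

theory Defs
  imports Complex_Main
begin

text \<open>A finite simple graph is given by its vertex set \<open>V\<close> and its edge set \<open>E\<close>, the edges
  being two-element subsets of \<open>V\<close>.\<close>

definition complete_edges :: "'a set \<Rightarrow> 'a set set" where
  "complete_edges V = {e. e \<subseteq> V \<and> card e = 2}"

definition simple_graph :: "'a set \<Rightarrow> 'a set set \<Rightarrow> bool" where
  "simple_graph V E \<longleftrightarrow> finite V \<and> E \<subseteq> complete_edges V"

definition proper_edge_coloring :: "'a set set \<Rightarrow> 'c set \<Rightarrow> ('a set \<Rightarrow> 'c) \<Rightarrow> bool" where
  "proper_edge_coloring E P col \<longleftrightarrow>
     (\<forall>e\<in>E. col e \<in> P) \<and>
     (\<forall>e\<in>E. \<forall>f\<in>E. e \<noteq> f \<and> e \<inter> f \<noteq> {} \<longrightarrow> col e \<noteq> col f)"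

definition chromatic_index :: "'a set set \<Rightarrow> nat" where
  "chromatic_index E = (LEAST k. \<exists>col. proper_edge_coloring E {..<k} col)"

definition chromatic_index_complete :: "nat \<Rightarrow> nat" where
  "chromatic_index_complete n = chromatic_index (complete_edges {..<n})"

text \<open>The colors in the palette need not all be used by the coloring.\<close>

definition maximal_edge_coloring :: "'a set \<Rightarrow> 'a set set \<Rightarrow> ('a set \<Rightarrow> nat) \<Rightarrow> bool" where
  "maximal_edge_coloring V E col \<longleftrightarrow>
     (let P = {..<chromatic_index_complete (card V)} in
        proper_edge_coloring E P col \<and>
        (\<forall>e \<in> complete_edges V - E. \<forall>c\<in>P.
           \<not> proper_edge_coloring (insert e E) P (col(e := c))))"

definition has_maximal_edge_coloring :: "'a set \<Rightarrow> 'a set set \<Rightarrow> bool" where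
  "has_maximal_edge_coloring V E \<longleftrightarrow> (\<exists>col. maximal_edge_coloring V E col)"

text \<open>Up to isomorphism every finite graph has its vertices in \<^typ>\<open>nat\<close>.\<close>

definition MEC :: "nat \<Rightarrow> nat set" where
  "MEC n = {m. \<exists>(V :: nat set) E. simple_graph V E \<and> card V = n \<and> card E = m \<and>
                 has_maximal_edge_coloring V E}"

lemma maximal_edge_coloring_iff:
  "maximal_edge_coloring V E col \<longleftrightarrow>
    proper_edge_coloring E {..<chromatic_index_complete (card V)} col \<and>
    (\<forall>u\<in>V. \<forall>v\<in>V. u \<noteq> v \<and> {u, v} \<notin> E \<longrightarrow>
       (\<forall>c\<in>{..<chromatic_index_complete (card V)}. \<exists>e\<in>E. (u \<in> e \<or> v \<in> e) \<and> col e = c))"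
proof -
  define P where "P = {..<chromatic_index_complete (card V)}"
  have step: "\<not> proper_edge_coloring (insert {u, v} E) P (col({u, v} := c)) \<longleftrightarrow>
      (\<exists>e\<in>E. (u \<in> e \<or> v \<in> e) \<and> col e = c)"
    if p: "proper_edge_coloring E P col" and "{u, v} \<notin> E" and "c \<in> P" for u v c
  proof -
    have ne: "\<And>e. e \<in> E \<Longrightarrow> e \<noteq> {u, v}" using that(2) by blast
    show ?thesis
      using p that(3) ne unfolding proper_edge_coloring_def
      by (auto simp: fun_upd_def)
  qed
  have ball: "(\<forall>e\<in>complete_edges V - E. Q e) \<longleftrightarrow>
      (\<forall>u\<in>V. \<forall>v\<in>V. u \<noteq> v \<and> {u, v} \<notin> E \<longrightarrow> Q {u, v})" for Q
    unfolding complete_edges_def by (auto simp: card_2_iff)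
  show ?thesis
    unfolding maximal_edge_coloring_def Let_def P_def[symmetric] ball
    using step by blast
qed

end

theory Submission
  imports Defs
begin

text \<open>Write \<open>k\<close> for the maximal number of non-neighbours of a vertex, and \<open>M\<close> for the set of
  vertices at which a given color is missing; by maximality \<open>M\<close> is a clique.

  If some color has \<open>card M > k\<close>, then the non-adjacent pairs all meet \<open>V - M\<close>, whose vertices have
  fewer than \<open>card M\<close> non-neighbours each, and counting non-adjacent pairs suffices.

  Otherwise let \<open>v\<close> have \<open>k\<close> non-neighbours, forming \<open>W\<close>, and pick \<open>k\<close> colors missing at \<open>v\<close>. All of
  them occur at every vertex of \<open>W\<close>, and since a vertex of \<open>W\<close> has only \<open>k - 1\<close> possible neighbours
  inside \<open>W\<close>, each sends an edge of such a color out of \<open>W\<close>. So these \<open>k\<close> colors have at least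
  \<open>k\<^sup>2 + k\<close> incidences, while each of \<open>n - 1 - k\<close> further colors occurs at \<open>n - k\<close> vertices or more.

  Both cases give \<open>n\<^sup>2 \<le> 4 m + 1\<close>, and for even \<open>n\<close> the summand \<open>1\<close> can be dropped.
  Of the palette only the trivial bound of at least \<open>n - 1\<close> colors is used.\<close>

lemma two_element_edge:
  assumes "E \<subseteq> complete_edges V" "e \<in> E" "v \<in> e"
  obtains u where "e = {v, u}" "u \<in> V" "v \<in> V" "u \<noteq> v"
proof -
  have "card e = 2" "e \<subseteq> V" using assms unfolding complete_edges_def by auto
  then show ?thesis using assms(3) that by (auto simp: card_2_iff)
qed

text \<open>Maximality is taken in the incidence form of \<open>maximal_edge_coloring_iff\<close>,
  over any finite palette with at least \<open>card V - 1\<close> colors.\<close>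

locale saturated_coloring =
  fixes V :: "'a set" and E :: "'a set set" and P :: "'c set" and col :: "'a set \<Rightarrow> 'c"
  assumes finite_V: "finite V"
    and edges: "E \<subseteq> complete_edges V"
    and finite_P: "finite P"
    and card_P: "card V \<le> card P + 1"
    and proper: "proper_edge_coloring E P col"
    and saturated: "\<lbrakk>u \<in> V; v \<in> V; u \<noteq> v; {u, v} \<notin> E; c \<in> P\<rbrakk>
      \<Longrightarrow> \<exists>e\<in>E. (u \<in> e \<or> v \<in> e) \<and> col e = c"
begin

section \<open>Colors at a vertex and incidence counts\<close>

definition seen :: "'a \<Rightarrow> 'c set" where
  "seen v = col ` {e \<in> E. v \<in> e}"

text \<open>The complement \<open>V - present c\<close> is the set \<open>M\<close> of the
  overview.\<close>

definition present :: "'c \<Rightarrow> 'a set" where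
  "present c = {v \<in> V. c \<in> seen v}"

definition non_neighbors :: "'a \<Rightarrow> 'a set" where
  "non_neighbors v = {u \<in> V. u \<noteq> v \<and> {u, v} \<notin> E}"

lemma finite_E: "finite E"
  by (rule finite_subset[of _ "Pow V"]) (use edges finite_V in \<open>auto simp: complete_edges_def\<close>)

lemma seen_subset: "seen v \<subseteq> P"
  using proper unfolding seen_def proper_edge_coloring_def by auto

lemma finite_seen: "finite (seen v)"
  using seen_subset finite_P finite_subset by blast

lemma finite_present: "finite (present c)"
  unfolding present_def using finite_V by simp

lemma finite_non_neighbors: "finite (non_neighbors v)"
  unfolding non_neighbors_def using finite_V by simp

lemma same_color_eq:
  assumes "e \<in> E" "f \<in> E" "x \<in> e" "x \<in> f" "col e = col f"
  shows "e = f"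
  using proper assms unfolding proper_edge_coloring_def by blast

lemma card_seen: "card (seen v) = card {e \<in> E. v \<in> e}"
  unfolding seen_def by (rule card_image) (auto intro!: inj_onI dest: same_color_eq)

text \<open>Properness gives each edge at \<open>v\<close> its own color, so
  \<open>card (seen v)\<close> is the degree of \<open>v\<close>.\<close>

lemma card_non_neighbors:
  assumes "v \<in> V"
  shows "card (non_neighbors v) + card (seen v) + 1 = card V"
proof -
  let ?N = "{u \<in> V. u \<noteq> v \<and> {u, v} \<in> E}"
  have "bij_betw (\<lambda>u. {u, v}) ?N {e \<in> E. v \<in> e}"
  proof (rule bij_betw_imageI)
    show "inj_on (\<lambda>u. {u, v}) ?N" by (auto simp: inj_on_def doubleton_eq_iff)
    show "(\<lambda>u. {u, v}) ` ?N = {e \<in> E. v \<in> e}"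
    proof (intro equalityI subsetI)
      fix e assume "e \<in> {e \<in> E. v \<in> e}"
      then show "e \<in> (\<lambda>u. {u, v}) ` ?N"
        using two_element_edge[OF edges, of e v] by (auto simp: insert_commute)
    qed auto
  qed
  then have "card ?N = card (seen v)"
    unfolding card_seen by (rule bij_betw_same_card)
  moreover have "V = insert v (non_neighbors v \<union> ?N)"
    using assms unfolding non_neighbors_def by auto
  then have "card V = card (insert v (non_neighbors v \<union> ?N))" by simp
  then have "card V = Suc (card (non_neighbors v \<union> ?N))"
    using finite_V finite_non_neighbors by (simp add: non_neighbors_def)
  moreover have "card (non_neighbors v \<union> ?N) = card (non_neighbors v) + card ?N"
    using finite_V finite_non_neighbors by (intro card_Un_disjoint) (auto simp: non_neighbors_def)
  ultimately show ?thesis by simp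
qed

lemma sum_card_seen: "(\<Sum>v\<in>V. card (seen v)) = 2 * card E"
proof -
  have "(\<Sum>v\<in>V. card {e \<in> E. v \<in> e}) = (\<Sum>e\<in>E. card {v \<in> V. v \<in> e})"
    by (rule sum_multicount_gen) (use finite_V finite_E in auto)
  also have "\<dots> = (\<Sum>e\<in>E. 2)"
  proof (rule sum.cong)
    fix e assume "e \<in> E"
    then have "{v \<in> V. v \<in> e} = e" "card e = 2" using edges unfolding complete_edges_def by auto
    then show "card {v \<in> V. v \<in> e} = 2" by simp
  qed simp
  finally show ?thesis by (simp add: card_seen)
qed

lemma sum_card_present: "(\<Sum>c\<in>P. card (present c)) = 2 * card E"
proof -
  have "(\<Sum>c\<in>P. card (present c)) = (\<Sum>v\<in>V. card {c \<in> P. c \<in> seen v})"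
    unfolding present_def by (rule sum_multicount_gen) (use finite_V finite_P in auto)
  also have "\<dots> = (\<Sum>v\<in>V. card (seen v))"
    by (intro sum.cong arg_cong[of _ _ card]) (use seen_subset in auto)
  finally show ?thesis using sum_card_seen by simp
qed

text \<open>A color missing at both ends could be put on the absent edge. Hence the vertices missing
  a given color are pairwise adjacent.\<close>

lemma seen_non_neighbor:
  assumes "v \<in> V" "w \<in> non_neighbors v" "c \<in> P" "c \<notin> seen v"
  shows "c \<in> seen w"
  using saturated[of w v c] assms unfolding non_neighbors_def seen_def by auto

section \<open>A color missing at many vertices\<close>

text \<open>Ordered non-adjacent pairs starting in \<open>S\<close> end in \<open>V - S\<close>, so
  they are at most as many as those starting in \<open>V - S\<close>, of which there are at most
  \<open>(n - s) * (s - 1)\<close>.\<close>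

lemma edge_bound_of_large_clique:
  assumes "S \<subseteq> V" and clique: "\<And>u. u \<in> S \<Longrightarrow> non_neighbors u \<inter> S = {}"
    and bound: "\<And>u. u \<in> V \<Longrightarrow> card (non_neighbors u) + 1 \<le> card S"
  shows "(card V)\<^sup>2 \<le> 4 * card E + 1"
proof -
  define n s where "n = int (card V)" and "s = int (card S)"
  let ?f = "\<lambda>u. int (card (non_neighbors u))"
  have fin: "finite S" "finite (V - S)" using assms(1) finite_V finite_subset by auto
  have card_diff: "int (card (V - S)) = n - s"
    using assms(1) finite_V card_mono[of V S] fin
    unfolding n_def s_def by (simp add: card_Diff_subset of_nat_diff)
  have "(\<Sum>u\<in>S. card (non_neighbors u)) = (\<Sum>u\<in>S. card {t \<in> V - S. t \<in> non_neighbors u})"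
    by (rule sum.cong) (use clique in \<open>auto intro!: arg_cong[of _ _ card] simp: non_neighbors_def\<close>)
  also have "\<dots> = (\<Sum>t\<in>V - S. card {u \<in> S. t \<in> non_neighbors u})"
    by (rule sum_multicount_gen) (use fin in auto)
  also have "\<dots> \<le> (\<Sum>t\<in>V - S. card (non_neighbors t))"
    by (intro sum_mono card_mono finite_non_neighbors)
      (use assms(1) in \<open>auto simp: non_neighbors_def insert_commute\<close>)
  finally have "(\<Sum>u\<in>S. ?f u) \<le> (\<Sum>t\<in>V - S. ?f t)"
    by (simp flip: of_nat_sum)
  moreover have "(\<Sum>t\<in>V - S. ?f t) \<le> (\<Sum>t\<in>V - S. s - 1)"
    by (rule sum_mono) (use bound in \<open>force simp: s_def\<close>)
  moreover have "(\<Sum>u\<in>V. ?f u) = (\<Sum>t\<in>V - S. ?f t) + (\<Sum>u\<in>S. ?f u)"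
    using sum.subset_diff[OF assms(1) finite_V] .
  ultimately have "(\<Sum>u\<in>V. ?f u) \<le> 2 * ((n - s) * (s - 1))"
    by (simp add: card_diff)
  moreover have "(\<Sum>u\<in>V. ?f u) = (\<Sum>u\<in>V. (n - 1) - int (card (seen u)))"
    by (rule sum.cong) (use card_non_neighbors in \<open>force simp: n_def\<close>)+
  then have "(\<Sum>u\<in>V. ?f u) = n * (n - 1) - 2 * int (card E)"
    using arg_cong[OF sum_card_seen, of int] by (simp add: sum_subtractf n_def)
  \<comment> \<open>This amounts to \<open>4 * (n - s) * (s - 1) \<le> (n - 1)\<^sup>2\<close>: the
    factors have sum \<open>n - 1\<close> and difference \<open>n + 1 - 2 * s\<close>.\<close>
  moreover have "0 \<le> (n + 1 - 2 * s)\<^sup>2" by simp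
  ultimately have "n\<^sup>2 \<le> 4 * int (card E) + 1"
    by (simp add: power2_eq_square algebra_simps)
  then have "int ((card V)\<^sup>2) \<le> int (4 * card E + 1)" by (simp add: n_def)
  then show ?thesis by linarith
qed

section \<open>Every color missing at few vertices\<close>

text \<open>Pigeonhole: \<open>w\<close> sees every color of \<open>B\<close>, but
  \<open>non_neighbors v\<close> contains one vertex other than \<open>w\<close> too few to carry
  them all.\<close>

lemma escaping_edge:
  assumes "v \<in> V" "w \<in> non_neighbors v"
    and "B \<subseteq> P - seen v" "card B = card (non_neighbors v)"
  obtains x where "x \<in> V - non_neighbors v" "{w, x} \<in> E" "col {w, x} \<in> B"
proof -
  let ?W = "non_neighbors v"
  have "\<exists>x. x \<in> V - ?W \<and> {w, x} \<in> E \<and> col {w, x} \<in> B"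
  proof (rule ccontr)
    assume none: "\<nexists>x. x \<in> V - ?W \<and> {w, x} \<in> E \<and> col {w, x} \<in> B"
    have "B \<subseteq> (\<lambda>u. col {w, u}) ` (?W - {w})"
    proof
      fix c assume c: "c \<in> B"
      then have "c \<in> seen w" using seen_non_neighbor assms by blast
      then obtain e where e: "e \<in> E" "w \<in> e" "col e = c" unfolding seen_def by auto
      then obtain u where "e = {w, u}" "u \<in> V" "u \<noteq> w"
        using two_element_edge[OF edges] by metis
      then show "c \<in> (\<lambda>u. col {w, u}) ` (?W - {w})" using none e c by auto
    qed
    then have "card B \<le> card (?W - {w})"
      using surj_card_le finite_non_neighbors by (metis finite_Diff)
    then show False
      using assms(2,4) card_Diff1_less[OF finite_non_neighbors assms(2)] by simp
  qed
  then show ?thesis using that by blast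
qed

lemma incidences_of_missing_colors:
  assumes v: "v \<in> V" and B: "B \<subseteq> P - seen v" "card B = k"
    and k: "card (non_neighbors v) = k"
  shows "k * k + k \<le> (\<Sum>c\<in>B. card (present c))"
proof -
  let ?W = "non_neighbors v"
  have finB: "finite B" using B(1) finite_P finite_subset by blast
  have "\<forall>w\<in>?W. \<exists>x. x \<in> V - ?W \<and> {w, x} \<in> E \<and> col {w, x} \<in> B"
    using escaping_edge[OF v _ B(1)] B(2) k by metis
  then obtain f where f: "\<And>w. w \<in> ?W \<Longrightarrow> f w \<in> V - ?W \<and> {w, f w} \<in> E \<and> col {w, f w} \<in> B"
    by metis
  \<comment> \<open>Escaping edges may share their outer end, so the color is recorded too; by
    properness the two determine the edge.\<close>
  define g where "g w = (col {w, f w}, f w)" for w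
  have "inj_on g ?W"
  proof (rule inj_onI)
    fix w w' assume w: "w \<in> ?W" "w' \<in> ?W" "g w = g w'"
    then have eq: "col {w, f w} = col {w', f w'}" "f w = f w'" unfolding g_def by auto
    have "{w, f w} \<in> E" "{w', f w'} \<in> E" using f w(1,2) by blast+
    then have "{w, f w} = {w', f w'}"
      using eq by (intro same_color_eq[of _ _ "f w"]) simp_all
    \<comment> \<open>This excludes that the two equal edges have their ends swapped.\<close>
    moreover have "w \<noteq> f w'" using f[OF w(2)] w(1) by blast
    ultimately show "w = w'" by (auto simp: doubleton_eq_iff)
  qed
  then have "card (g ` ?W) = k" using k by (simp add: card_image)
  moreover have "(B \<times> ?W) \<inter> g ` ?W = {}" using f unfolding g_def by auto
  ultimately have "k * k + k = card (B \<times> ?W \<union> g ` ?W)"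
    using B(2) k finB finite_non_neighbors by (simp add: card_Un_disjoint card_cartesian_product)
  also have "\<dots> \<le> card (SIGMA c:B. present c)"
  proof (rule card_mono)
    have "B \<times> ?W \<subseteq> (SIGMA c:B. present c)"
      using seen_non_neighbor[OF v] B(1) unfolding present_def by (auto simp: non_neighbors_def)
    moreover have "g ` ?W \<subseteq> (SIGMA c:B. present c)"
      using f unfolding g_def present_def seen_def by auto
    ultimately show "B \<times> ?W \<union> g ` ?W \<subseteq> (SIGMA c:B. present c)" by simp
  qed (use finB finite_present in auto)
  also have "\<dots> = (\<Sum>c\<in>B. card (present c))"
    using finB finite_present by simp
  finally show ?thesis .
qed

lemma edge_bound_of_small_missing_sets:
  assumes v: "v \<in> V" and k: "card (non_neighbors v) = k"
    and small: "\<And>c. c \<in> P \<Longrightarrow> card (V - present c) \<le> k"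
  shows "(card V)\<^sup>2 \<le> 4 * card E + 1"
proof -
  define n where "n = card V"
  have kn: "k + card (seen v) + 1 = n" using card_non_neighbors[OF v] k n_def by simp
  have "card (P - seen v) = card P - card (seen v)"
    using seen_subset finite_seen by (simp add: card_Diff_subset)
  then have "k \<le> card (P - seen v)" using kn card_P n_def by simp
  then obtain B where B: "B \<subseteq> P - seen v" "card B = k" "finite B"
    by (rule obtain_subset_with_card_n)
  then have "card (P - B) = card P - k" by (subst card_Diff_subset) auto
  \<comment> \<open>Keeping exactly \<open>n - 1 - k\<close> further colors makes the bound depend
    on \<open>n\<close> and \<open>k\<close> only, whatever the size of the palette.\<close>
  then have "n - 1 - k \<le> card (P - B)" using card_P n_def by simp
  then obtain A where A: "A \<subseteq> P - B" "card A = n - 1 - k" "finite A"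
    by (rule obtain_subset_with_card_n)
  have "n - k \<le> card (present c)" if "c \<in> A" for c
  proof -
    have "present c \<subseteq> V" unfolding present_def by auto
    then have "card (V - present c) = n - card (present c)"
      using finite_present by (simp add: card_Diff_subset n_def)
    then show ?thesis using small[of c] A that by auto
  qed
  then have "(n - 1 - k) * (n - k) \<le> (\<Sum>c\<in>A. card (present c))"
    using sum_bounded_below[of A "n - k" "\<lambda>c. card (present c)"] A by simp
  then have "(k * k + k) + (n - 1 - k) * (n - k)
      \<le> (\<Sum>c\<in>B. card (present c)) + (\<Sum>c\<in>A. card (present c))"
    using incidences_of_missing_colors[OF v B(1,2) k] by simp
  also have "\<dots> = (\<Sum>c\<in>B \<union> A. card (present c))"
    by (rule sum.union_disjoint[symmetric]) (use A B in auto)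
  also have "\<dots> \<le> (\<Sum>c\<in>P. card (present c))"
    by (rule sum_mono2) (use A B finite_P in auto)
  finally have le: "(k * k + k) + (n - 1 - k) * (n - k) \<le> 2 * card E"
    by (simp add: sum_card_present)
  \<comment> \<open>Here \<open>d\<close> is the degree of \<open>v\<close>.\<close>
  obtain d where d: "n = k + d + 1" using kn by (metis add.assoc)
  have "(k * k + k) + d * (d + 1) \<le> 2 * card E"
    using le unfolding d by (simp add: algebra_simps)
  then have "int ((k * k + k) + d * (d + 1)) \<le> int (2 * card E)"
    by (rule of_nat_mono)
  \<comment> \<open>Since \<open>k + d = n - 1\<close>, twice the sum
    \<open>k * k + k + d * (d + 1)\<close> equals
    \<open>n\<^sup>2 - 1 + (d - k)\<^sup>2\<close>.\<close>
  moreover have "0 \<le> (int d - int k)\<^sup>2" by simp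
  ultimately have "int (n\<^sup>2) \<le> int (4 * card E + 1)"
    unfolding d by (simp add: power2_eq_square algebra_simps)
  then show ?thesis unfolding n_def by linarith
qed

lemma edge_bound: "(card V)\<^sup>2 \<le> 4 * card E + 1"
proof (cases "V = {}")
  case False
  define k where "k = Max ((\<lambda>v. card (non_neighbors v)) ` V)"
  have "k \<in> (\<lambda>v. card (non_neighbors v)) ` V"
    unfolding k_def using False finite_V by (intro Max_in) auto
  then obtain v where v: "v \<in> V" "card (non_neighbors v) = k" by auto
  have max: "card (non_neighbors u) \<le> k" if "u \<in> V" for u
    unfolding k_def using that finite_V by (intro Max_ge) auto
  show ?thesis
  proof (cases "\<exists>c\<in>P. k < card (V - present c)")
    case True
    then obtain c where c: "c \<in> P" "k < card (V - present c)" by blast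
    show ?thesis
    proof (rule edge_bound_of_large_clique)
      show "non_neighbors u \<inter> (V - present c) = {}" if "u \<in> V - present c" for u
        using seen_non_neighbor[of u _ c] that c(1) unfolding present_def by auto
      show "card (non_neighbors u) + 1 \<le> card (V - present c)" if "u \<in> V" for u
        using max[OF that] c(2) by simp
    qed simp
  next
    case False
    then show ?thesis using edge_bound_of_small_missing_sets[OF v] by (meson not_less)
  qed
qed simp

end

text \<open>The \<open>n - 1\<close> edges at one vertex of the complete graph need distinct
  colors.\<close>

lemma chromatic_index_complete_ge: "n \<le> chromatic_index_complete n + 1"
proof (cases n)
  case (Suc m)
  let ?E = "complete_edges {..<n}"
  have "finite ?E"
    by (rule finite_subset[of _ "Pow {..<n}"]) (auto simp: complete_edges_def)
  \<comment> \<open>An injective coloring is proper, so the \<open>LEAST\<close> in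
    \<open>chromatic_index\<close> is attained.\<close>
  then obtain h :: "nat set \<Rightarrow> nat" and N where "h ` ?E = {i. i < N}" "inj_on h ?E"
    using finite_imp_inj_to_nat_seg by blast
  then have "proper_edge_coloring ?E {..<N} h"
    unfolding proper_edge_coloring_def by (auto simp: inj_on_def)
  then have "\<exists>k :: nat. \<exists>col. proper_edge_coloring ?E {..<k} col" by blast
  from LeastI_ex[OF this]
  obtain col where col: "proper_edge_coloring ?E {..<chromatic_index_complete n} col"
    unfolding chromatic_index_complete_def chromatic_index_def by blast
  have edge: "{i, m} \<in> ?E" if "i < m" for i
    using that Suc unfolding complete_edges_def by auto
  have "inj_on (\<lambda>i. col {i, m}) {..<m}"
  proof (rule inj_onI)
    fix i j assume "i \<in> {..<m}" "j \<in> {..<m}" "col {i, m} = col {j, m}"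
    moreover from this have "{i, m} \<in> ?E" "{j, m} \<in> ?E" "{i, m} \<inter> {j, m} \<noteq> {}"
      using edge by auto
    ultimately have "{i, m} = {j, m}"
      using col unfolding proper_edge_coloring_def by metis
    then show "i = j" by (auto simp: doubleton_eq_iff)
  qed
  moreover have "(\<lambda>i. col {i, m}) ` {..<m} \<subseteq> {..<chromatic_index_complete n}"
    using col edge unfolding proper_edge_coloring_def by (intro image_subsetI) simp
  ultimately have "card {..<m} \<le> card {..<chromatic_index_complete n}"
    by (rule card_inj_on_le) simp
  then show ?thesis using Suc by simp
qed simp

lemma maximal_edge_coloring_edge_bound:
  assumes "simple_graph V E" "has_maximal_edge_coloring V E"
  shows "(card V)\<^sup>2 \<le> 4 * card E + 1"
proof -
  obtain col where "maximal_edge_coloring V E col"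
    using assms(2) unfolding has_maximal_edge_coloring_def by blast
  then interpret saturated_coloring V E "{..<chromatic_index_complete (card V)}" col
    using assms(1) chromatic_index_complete_ge[of "card V"]
    unfolding maximal_edge_coloring_iff simple_graph_def by unfold_locales auto
  show ?thesis by (rule edge_bound)
qed

lemma maximal_edge_coloring_even_edge_bound:
  assumes "simple_graph V E" "has_maximal_edge_coloring V E" "even (card V)"
  shows "real (card E) \<ge> 1 / 4 * (real (card V))\<^sup>2"
proof -
  obtain p where p: "card V = 2 * p" using assms(3) by blast
  have "4 * p\<^sup>2 \<le> 4 * card E + 1"
    using maximal_edge_coloring_edge_bound[OF assms(1,2)] p by (simp add: power_mult_distrib)
  \<comment> \<open>The summand \<open>1\<close> disappears because the other two terms are
    divisible by \<open>4\<close>.\<close>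
  then have "p\<^sup>2 \<le> card E" by linarith
  then have "real (p\<^sup>2) \<le> real (card E)" by (rule of_nat_mono)
  then show ?thesis using p by (simp add: power_mult_distrib)
qed

theorem theorem3:
  fixes n :: nat
  assumes "n \<ge> 4" and "even n"
  shows "(\<forall>(V :: 'a set) E m. simple_graph V E \<and> card V = n \<and> card E = m \<and>
            has_maximal_edge_coloring V E \<longrightarrow> real m \<ge> 1 / 4 * (real n)\<^sup>2)
       \<and> (\<forall>m \<in> MEC n. real m \<ge> 1 / 4 * (real n)\<^sup>2)"
  unfolding MEC_def using assms(2) by (auto intro: maximal_edge_coloring_even_edge_bound[simplified])

end
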